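(* Let $L\ge1$, $n\in\mathbb{N}$, and let $\mathscr{E}_L$ be a sandwichable family of subsets of $[0,1]^n$. For all $\epsilon,M>0$ there exist $k=k(\epsilon,M,n,\mathscr{E}_L)\in\mathbb{N}$ and $\delta=\delta(\epsilon,M,n,\mathscr{E}_L)>0$ such that the following holds. Suppose $h\in L^2(\mathbb{R}^n)$ and a dyadic cube $Q\in\mathcal{D}(\mathbb{R}^n)$ satisfy (1) $h\ge0$ Lebesgue-almost everywhere, (2) $\|h\|_{L^2(Q)}^2\le M\ell(Q)^n$, (3) $\Delta_k^h(Q)^2\le\delta\,\ell(Q)^n$. Then for every $E\in\mathscr{E}_L(Q)$, $$\left|\frac1{\mathscr{L}(E)}\int_Eh\,d\mathscr{L}-\frac1{\mathscr{L}(Q)}\int_Qh\,d\mathscr{L}\right|\le\epsilon .$$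
   Context: $\mathscr{L}$ is Lebesgue measure on $\mathbb{R}^n$; $\mathcal{D}(\mathbb{R}^n)$ is the family of dyadic cubes, $\ell(Q)$ the side length of $Q$, and $\mathcal{D}_j(Q)$ the set of dyadic cubes $R\subseteq Q$ with $\ell(R)=2^{-j}\ell(Q)$. For $h:\mathbb{R}^n\to\mathbb{R}$ locally integrable and $R\in\mathcal{D}(\mathbb{R}^n)$, $\Delta_Rh(x)=\frac1{\mathscr{L}(P)}\int_Ph-\frac1{\mathscr{L}(R)}\int_Rh$ if $x\in P$ where $P$ is a dyadic child of $R$, and $\Delta_Rh(x)=0$ if $x\notin R$. For $k\in\mathbb{N}$, $\Delta_k^h(Q)^2=\sum_{j=0}^k\sum_{R\in\mathcal{D}_j(Q)}\|\Delta_Rh\|_{L^2}^2$. Sandwichable family: a family $\mathscr{E}_L$ of Lebesgue measurable subsets of $[0,1]^n$, with $\mathscr{L}(E)\ge c$ for all $E\in\mathscr{E}_L$ for some constant $c=c(L,n)>0$, is sandwichable if every sequence $E_j\in\mathscr{E}_L$ has a subsequence $E_{j_k}$ for which there are families of measurable sets $\{L_\epsilon\}_{0<\epsilon<1/2}$ and $\{U_\epsilon\}_{0<\epsilon<1/2}$ such that: (a) for every $0<\epsilon<1/2$ there is $k_0>0$ with $L_\epsilon\subseteq E_{j_k}\subseteq U_\epsilon$ for all $k\ge k_0$; (b) for $\epsilon'<\epsilon$, $L_\epsilon\subseteq L_{\epsilon'}$ and $U_{\epsilon'}\subseteq U_\epsilon$; (c) $\mathscr{L}(L_\epsilon)/\mathscr{L}(U_\epsilon)\ge1-\epsilon$.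 For $Q\in\mathcal{D}(\mathbb{R}^n)$, $T_Q$ is the affine map (translation composed with dilation by $\ell(Q)$) sending $[0,1]^n$ onto $Q$ (up to boundary), and $\mathscr{E}_L(Q)=\{T_Q(E):E\in\mathscr{E}_L\}$. *)

theory Defs
  imports "HOL-Analysis.Analysis"
begin

definition half_open_cube :: "real ^ 'n \<Rightarrow> real \<Rightarrow> (real ^ 'n) set" where
  "half_open_cube a s = {x. \<forall>i. a $ i \<le> x $ i \<and> x $ i < a $ i + s}"

text \<open>Dyadic cubes are taken half-open, so that the cubes of a fixed side length partition
  the space and every point of a cube lies in exactly one of its children.\<close>

definition dyadic_cubes :: "(real ^ 'n) set set" where
  "dyadic_cubes =
     {half_open_cube (\<chi> i. of_int (m i) * 2 powi j) (2 powi j) | (m :: 'n \<Rightarrow> int) (j :: int). True}"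

text \<open>Only used for half-open cubes, which determine their corner and side length
  (see \<open>cube_corner_eq\<close> and \<open>side_length_eq\<close> below).\<close>

definition cube_corner :: "(real ^ 'n) set \<Rightarrow> real ^ 'n" where
  "cube_corner Q = (THE a. \<exists>s>0. Q = half_open_cube a s)"

definition side_length :: "(real ^ 'n) set \<Rightarrow> real" where
  "side_length Q = (THE s. s > 0 \<and> (\<exists>a. Q = half_open_cube a s))"

definition dyadic_descendants :: "nat \<Rightarrow> (real ^ 'n) set \<Rightarrow> (real ^ 'n) set set" where
  "dyadic_descendants j Q =
     {R \<in> dyadic_cubes. R \<subseteq> Q \<and> side_length R = side_length Q / 2 ^ j}"

abbreviation dyadic_children :: "(real ^ 'n) set \<Rightarrow> (real ^ 'n) set set" where
  "dyadic_children \<equiv> dyadic_descendants 1"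

definition square_integrable :: "(real ^ 'n \<Rightarrow> real) \<Rightarrow> bool" where
  "square_integrable h \<longleftrightarrow>
     h \<in> borel_measurable lebesgue \<and> integrable lebesgue (\<lambda>x. (h x)\<^sup>2)"

definition L2_norm_on :: "(real ^ 'n) set \<Rightarrow> (real ^ 'n \<Rightarrow> real) \<Rightarrow> real" where
  "L2_norm_on A h = sqrt (LINT x:A|lebesgue. (h x)\<^sup>2)"

definition average :: "(real ^ 'n \<Rightarrow> real) \<Rightarrow> (real ^ 'n) set \<Rightarrow> real" where
  "average h A = (LINT x:A|lebesgue. h x) / measure lebesgue A"

definition martingale_difference :: "(real ^ 'n) set \<Rightarrow> (real ^ 'n \<Rightarrow> real) \<Rightarrow> real ^ 'n \<Rightarrow> real" where
  "martingale_difference R h x =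
     (if x \<in> R then average h (THE P. P \<in> dyadic_children R \<and> x \<in> P) - average h R else 0)"

text \<open>The quantity \<open>\<Delta>\<^sub>k\<^sup>h(Q)\<^sup>2\<close>; the square is part of the notation.\<close>

definition Delta_squared :: "nat \<Rightarrow> (real ^ 'n \<Rightarrow> real) \<Rightarrow> (real ^ 'n) set \<Rightarrow> real" where
  "Delta_squared k h Q =
     (\<Sum>j=0..k. \<Sum>R\<in>dyadic_descendants j Q. (L2_norm_on UNIV (martingale_difference R h))\<^sup>2)"

text \<open>In condition (c) the real-valued measure is harmless: if \<open>U \<epsilon>\<close> had infinite
  measure the quotient would be 0, as it is in the extended reals (\<open>Lo \<epsilon>\<close> is contained in the
  unit cube by (a)), and \<open>1 - \<epsilon> > 0\<close>.\<close>

definition sandwichable :: "(real ^ 'n) set set \<Rightarrow> bool" where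
  "sandwichable \<E> \<longleftrightarrow>
     (\<forall>E\<in>\<E>. E \<in> sets lebesgue \<and> E \<subseteq> cbox 0 1) \<and>
     (\<exists>c>0. \<forall>E\<in>\<E>. measure lebesgue E \<ge> c) \<and>
     (\<forall>F :: nat \<Rightarrow> (real ^ 'n) set. range F \<subseteq> \<E> \<longrightarrow>
       (\<exists>(r :: nat \<Rightarrow> nat) (Lo :: real \<Rightarrow> (real ^ 'n) set) (U :: real \<Rightarrow> (real ^ 'n) set).
          strict_mono r \<and>
          (\<forall>\<epsilon>\<in>{0<..<1/2}. Lo \<epsilon> \<in> sets lebesgue \<and> U \<epsilon> \<in> sets lebesgue) \<and>
          (\<forall>\<epsilon>\<in>{0<..<1/2}. \<exists>k0>0. \<forall>k\<ge>k0. Lo \<epsilon> \<subseteq> F (r k) \<and> F (r k) \<subseteq> U \<epsilon>) \<and>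
          (\<forall>\<epsilon>\<in>{0<..<1/2}. \<forall>\<epsilon>'\<in>{0<..<1/2}. \<epsilon>' < \<epsilon> \<longrightarrow> Lo \<epsilon> \<subseteq> Lo \<epsilon>' \<and> U \<epsilon>' \<subseteq> U \<epsilon>) \<and>
          (\<forall>\<epsilon>\<in>{0<..<1/2}. measure lebesgue (Lo \<epsilon>) / measure lebesgue (U \<epsilon>) \<ge> 1 - \<epsilon>)))"

definition cube_map :: "(real ^ 'n) set \<Rightarrow> real ^ 'n \<Rightarrow> real ^ 'n" where
  "cube_map Q x = cube_corner Q + side_length Q *\<^sub>R x"

definition rescaled_family :: "(real ^ 'n) set set \<Rightarrow> (real ^ 'n) set \<Rightarrow> (real ^ 'n) set set" where
  "rescaled_family \<E> Q = {cube_map Q ` E | E. E \<in> \<E>}"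


subsection \<open>Well-definedness\<close>

lemma half_open_cube_subset_iff:
  fixes a b :: "real ^ 'n"
  assumes "s > 0"
  shows "half_open_cube a s \<subseteq> half_open_cube b t \<longleftrightarrow> (\<forall>i. b $ i \<le> a $ i \<and> a $ i + s \<le> b $ i + t)"
proof
  assume sub: "half_open_cube a s \<subseteq> half_open_cube b t"
  have a: "a \<in> half_open_cube b t"
    using sub assms by (auto simp: half_open_cube_def)
  show "\<forall>i. b $ i \<le> a $ i \<and> a $ i + s \<le> b $ i + t"
  proof (intro allI conjI)
    fix i
    show "b $ i \<le> a $ i" using a by (auto simp: half_open_cube_def)
    show "a $ i + s \<le> b $ i + t"
    proof (rule ccontr)
      assume neg: "\<not> a $ i + s \<le> b $ i + t"
      define x where "x = (\<chi> k. if k = i then b $ i + t else a $ k)"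
      have "a $ i < b $ i + t" using a by (auto simp: half_open_cube_def)
      then have "x \<in> half_open_cube a s"
        using neg assms by (auto simp: half_open_cube_def x_def)
      then have "x \<in> half_open_cube b t" using sub by auto
      then have "x $ i < b $ i + t" by (simp add: half_open_cube_def)
      then show False by (simp add: x_def)
    qed
  qed
next
  assume le: "\<forall>i. b $ i \<le> a $ i \<and> a $ i + s \<le> b $ i + t"
  show "half_open_cube a s \<subseteq> half_open_cube b t"
  proof
    fix x assume x: "x \<in> half_open_cube a s"
    have "b $ i \<le> x $ i \<and> x $ i < b $ i + t" for i
    proof -
      have "a $ i \<le> x $ i" "x $ i < a $ i + s" "b $ i \<le> a $ i" "a $ i + s \<le> b $ i + t"
        using x le by (auto simp: half_open_cube_def)
      then show ?thesis by linarith
    qed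
    then show "x \<in> half_open_cube b t" by (simp add: half_open_cube_def)
  qed
qed

lemma half_open_cube_inject:
  fixes a b :: "real ^ 'n"
  assumes "s > 0" "t > 0" "half_open_cube a s = half_open_cube b t"
  shows "a = b \<and> s = t"
proof -
  have "\<forall>i. b $ i \<le> a $ i \<and> a $ i + s \<le> b $ i + t"
    using half_open_cube_subset_iff[OF assms(1), of a b t] assms(3) by simp
  moreover have "\<forall>i. a $ i \<le> b $ i \<and> b $ i + t \<le> a $ i + s"
    using half_open_cube_subset_iff[OF assms(2), of b a s] assms(3) by simp
  ultimately have eq: "a $ i = b $ i" "s = t" for i
    by (metis order_antisym, metis add_le_cancel_left order_antisym)
  then show ?thesis by (simp add: vec_eq_iff)
qed

lemma cube_corner_eq [simp]: "s > 0 \<Longrightarrow> cube_corner (half_open_cube a s) = a"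
  unfolding cube_corner_def by (rule the_equality) (auto dest: half_open_cube_inject)

lemma side_length_eq [simp]: "s > 0 \<Longrightarrow> side_length (half_open_cube a s) = s"
  unfolding side_length_def by (rule the_equality) (auto dest: half_open_cube_inject)

lemma finite_dyadic_descendants:
  assumes "Q \<in> dyadic_cubes"
  shows "finite (dyadic_descendants j Q)"
proof -
  obtain p :: "'a \<Rightarrow> int" and q :: int
    where Q: "Q = half_open_cube (\<chi> i. of_int (p i) * 2 powi q) (2 powi q)"
    using assms by (auto simp: dyadic_cubes_def)
  define s :: real where "s = 2 powi q / 2 ^ j"
  have s: "s > 0" by (simp add: s_def)
  define B where "B = (\<lambda>i. {p i * 2 ^ j .. (p i + 1) * 2 ^ j})"
  have "dyadic_descendants j Q \<subseteq> (\<lambda>m. half_open_cube (\<chi> i. of_int (m i) * s) s) ` (Pi\<^sub>E UNIV B)"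
  proof
    fix R assume "R \<in> dyadic_descendants j Q"
    then obtain m :: "'a \<Rightarrow> int" and l :: int
      where R: "R = half_open_cube (\<chi> i. of_int (m i) * 2 powi l) (2 powi l)"
        and sub: "R \<subseteq> Q" and len: "side_length R = side_length Q / 2 ^ j"
      by (auto simp: dyadic_descendants_def dyadic_cubes_def)
    have l: "2 powi l = s" using len by (simp add: R Q s_def)
    have q: "2 powi q = s * 2 ^ j" by (simp add: s_def)
    have "m i \<in> B i" for i
    proof -
      have "of_int (p i) * (s * 2 ^ j) \<le> of_int (m i) * s"
        and "of_int (m i) * s + s \<le> of_int (p i) * (s * 2 ^ j) + s * 2 ^ j"
        using sub s half_open_cube_subset_iff[of s "\<chi> i. of_int (m i) * s"]
        unfolding R Q l q by auto
      then have "s * of_int (p i * 2 ^ j) \<le> s * of_int (m i)"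
        and "s * of_int (m i) \<le> s * of_int ((p i + 1) * 2 ^ j)"
        using s by (auto simp: algebra_simps)
      then have "p i * 2 ^ j \<le> m i" and "m i \<le> (p i + 1) * 2 ^ j"
        using s by (simp_all only: mult_le_cancel_left_pos of_int_le_iff)
      then show ?thesis by (simp add: B_def)
    qed
    then show "R \<in> (\<lambda>m. half_open_cube (\<chi> i. of_int (m i) * s) s) ` (Pi\<^sub>E UNIV B)"
      unfolding R l by auto
  qed
  moreover have "finite (Pi\<^sub>E (UNIV :: 'a set) B)"
    by (rule finite_PiE) (auto simp: B_def)
  ultimately show ?thesis by (meson finite_imageI finite_subset)
qed

lemma dyadic_child_unique:
  assumes "R \<in> dyadic_cubes" "x \<in> R"
  shows "\<exists>!P. P \<in> dyadic_children R \<and> x \<in> P"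
proof -
  obtain p :: "'a \<Rightarrow> int" and q :: int
    where R: "R = half_open_cube (\<chi> i. of_int (p i) * 2 powi q) (2 powi q)"
    using assms by (auto simp: dyadic_cubes_def)
  define s :: real where "s = 2 powi (q - 1)"
  have s: "s > 0" by (simp add: s_def)
  have q: "2 powi q = 2 * s" by (simp add: s_def power_int_diff)
  define m where "m = (\<lambda>i. \<lfloor>x $ i / s\<rfloor>)"
  define P where "P = half_open_cube (\<chi> i. of_int (m i) * s) s"
  have xi: "of_int (p i) * (2 * s) \<le> x $ i" "x $ i < of_int (p i) * (2 * s) + 2 * s" for i
    using assms(2) unfolding R q by (auto simp: half_open_cube_def)
  have mi: "2 * p i \<le> m i" "m i + 1 \<le> 2 * p i + 2" for i
  proof -
    have "of_int (2 * p i) \<le> x $ i / s" using xi(1)[of i] s by (simp add: field_simps)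
    then show "2 * p i \<le> m i" by (simp add: m_def le_floor_iff)
    have "x $ i / s < of_int (2 * p i + 2)" using xi(2)[of i] s by (simp add: field_simps)
    then show "m i + 1 \<le> 2 * p i + 2" by (simp add: m_def floor_less_iff add1_zle_eq)
  qed
  have "P \<subseteq> R"
    unfolding P_def R q half_open_cube_subset_iff[OF s]
  proof (intro allI conjI)
    fix i
    have a: "real_of_int (2 * p i) \<le> of_int (m i)"
      and b: "real_of_int (m i + 1) \<le> of_int (2 * p i + 2)"
      using mi[of i] by (simp_all only: of_int_le_iff)
    show "(\<chi> i. of_int (p i) * (2 * s)) $ i \<le> (\<chi> i. of_int (m i) * s) $ i"
      using mult_right_mono[OF a, of s] s by (simp add: algebra_simps)
    show "(\<chi> i. of_int (m i) * s) $ i + s \<le> (\<chi> i. of_int (p i) * (2 * s)) $ i + 2 * s"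
      using mult_right_mono[OF b, of s] s by (simp add: algebra_simps)
  qed
  moreover have "P \<in> dyadic_cubes" unfolding P_def dyadic_cubes_def s_def by blast
  ultimately have "P \<in> dyadic_children R"
    using s by (simp add: dyadic_descendants_def P_def R q)
  moreover have "x \<in> P"
    using s by (auto simp: P_def half_open_cube_def m_def floor_divide_lower)
      (metis floor_divide_upper distrib_right mult_1)
  moreover have "P' = P" if P': "P' \<in> dyadic_children R" "x \<in> P'" for P'
  proof -
    obtain m' :: "'a \<Rightarrow> int" and l :: int
      where P'_eq: "P' = half_open_cube (\<chi> i. of_int (m' i) * 2 powi l) (2 powi l)"
        and len: "side_length P' = side_length R / 2"
      using P'(1) by (auto simp: dyadic_descendants_def dyadic_cubes_def)
    have l: "2 powi l = s" using len s by (simp add: P'_eq R q)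
    have "m' i = m i" for i
      using P'(2) s unfolding P'_eq l m_def half_open_cube_def
      by (auto intro!: floor_unique[symmetric] simp: field_simps)
    then show ?thesis by (simp add: P'_eq l P_def)
  qed
  ultimately show ?thesis by blast
qed

lemma martingale_difference_child:
  assumes "R \<in> dyadic_cubes" "P \<in> dyadic_children R" "x \<in> P"
  shows "martingale_difference R h x = average h P - average h R"
proof -
  have x: "x \<in> R" using assms by (auto simp: dyadic_descendants_def)
  have "(THE P. P \<in> dyadic_children R \<and> x \<in> P) = P"
    using dyadic_child_unique[OF assms(1) x] assms(2,3) by (intro the1_equality) auto
  with x show ?thesis by (simp add: martingale_difference_def)
qed

end

theory Submission
  imports Defs
begin

text \<open>
  Sandwichability is a compactness property: a subsequence squeezed between \<open>L\<^sub>\<epsilon>\<close> and \<open>U\<^sub>\<epsilon>\<close>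
  differs from \<open>L\<^sub>\<epsilon>\<close> by a set of measure at most \<open>2\<epsilon>\<close>. Hence the indicator functions of a
  sandwichable family are precompact in \<open>L\<^sup>1\<close>, and since each measurable set is a limit in measure
  of unions of dyadic cubes, one generation \<open>m\<close> suffices to approximate all members of the family
  within a prescribed \<open>\<eta>\<close> by unions of generation-\<open>m\<close> cubes
  (\<open>sandwichable_uniform_pixelation\<close>). This \<open>m\<close> depends only on \<open>\<eta>\<close> and the family, and it is
  the number \<open>k\<close> of the theorem.

  With \<open>m\<close> fixed, there are finitely many generations to control. A martingale difference
  \<open>\<Delta>\<^sub>R h\<close> is constant on each child of \<open>R\<close>, so a small \<open>L\<^sup>2\<close> norm forces it to be uniformly small,
  with a loss that depends on the size of the child and so on \<open>m\<close> and the dimension alone.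
  Summing along the chain of cubes from \<open>Q\<close> to a generation-\<open>m\<close> cube \<open>R\<close> shows that the averages
  of \<open>h\<close> over \<open>R\<close> and \<open>Q\<close> are within \<open>\<tau>\<close> of each other once \<open>\<delta>\<close> is small
  (\<open>average_dyadic_descendant_bound\<close>).

  Let \<open>a\<close> be the average of \<open>h\<close> over \<open>Q\<close> and \<open>A\<close> the union of cubes approximating \<open>E\<close>. The integral
  of \<open>h - a\<close> over \<open>A\<close> is in absolute value at most \<open>\<tau>\<close> times the measure of \<open>Q\<close> by the previous step, and its
  integral over the symmetric difference of \<open>E\<close> and \<open>A\<close> is small by Young's inequality and the
  \<open>L\<^sup>2\<close> bound on \<open>h\<close> (\<open>set_integral_deviation\<close>). Dividing by the measure of \<open>E\<close>, which is bounded
  below by a multiple of that of \<open>Q\<close>, gives the claim.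
\<close>

section \<open>Dyadic cubes\<close>

lemma
  fixes a :: "real ^ 'n"
  assumes "s > 0"
  shows half_open_cube_lmeasurable: "half_open_cube a s \<in> lmeasurable"
    and measure_half_open_cube: "measure lebesgue (half_open_cube a s) = s ^ CARD('n)"
    and negligible_cbox_minus_half_open_cube:
      "negligible (cbox a (a + (\<chi> i. s)) - half_open_cube a s)"
proof -
  let ?b = "a + (\<chi> i. s)"
  have box: "box a ?b \<subseteq> half_open_cube a s" "half_open_cube a s \<subseteq> cbox a ?b"
    by (auto simp: half_open_cube_def mem_box_cart less_imp_le)
  have negl: "negligible (cbox a ?b - box a ?b)"
    by (rule negligible_frontier_interval)
  show neg: "negligible (cbox a ?b - half_open_cube a s)"
    by (rule negligible_subset[OF negl]) (use box in auto)
  have diff: "sym_diff (cbox a ?b) (half_open_cube a s) = cbox a ?b - half_open_cube a s"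
    using box by auto
  show "half_open_cube a s \<in> lmeasurable"
    by (rule lmeasurable_negligible_symdiff[OF lmeasurable_cbox[of a ?b]]) (simp only: diff neg)
  have "measure lebesgue (half_open_cube a s) = measure lebesgue (cbox a ?b)"
    by (rule measure_negligible_symdiff[OF lmeasurable_cbox[of a ?b]]) (simp only: diff neg)
  also have "\<dots> = s ^ CARD('n)"
    using content_cbox_cart[of a ?b] assms by (simp add: interval_ne_empty_cart)
  finally show "measure lebesgue (half_open_cube a s) = s ^ CARD('n)" .
qed

lemma dyadic_cubeE:
  assumes "Q \<in> dyadic_cubes"
  obtains a s where "s > 0" "Q = half_open_cube a s"
proof -
  obtain m and j :: int where "Q = half_open_cube (\<chi> i. of_int (m i) * 2 powi j) (2 powi j)"
    using assms by (auto simp: dyadic_cubes_def)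
  then show ?thesis by (intro that[of "2 powi j"]) auto
qed

lemma side_length_pos: "Q \<in> dyadic_cubes \<Longrightarrow> side_length Q > 0"
  by (erule dyadic_cubeE) simp

lemma
  fixes Q :: "(real ^ 'n) set"
  assumes "Q \<in> dyadic_cubes"
  shows dyadic_cube_lmeasurable: "Q \<in> lmeasurable"
    and measure_dyadic_cube: "measure lebesgue Q = side_length Q ^ CARD('n)"
  using assms
  by (auto elim!: dyadic_cubeE simp: half_open_cube_lmeasurable measure_half_open_cube)

lemma measure_dyadic_cube_pos: "Q \<in> dyadic_cubes \<Longrightarrow> measure lebesgue Q > 0"
  by (simp add: measure_dyadic_cube side_length_pos)

text \<open>The integer index of a cube of side \<open>s\<close> is read off from any of its points as \<open>\<lfloor>x $ i / s\<rfloor>\<close>.\<close>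

lemma dyadic_cubes_same_size_eq:
  assumes "R \<in> dyadic_cubes" "R' \<in> dyadic_cubes" "side_length R = side_length R'"
    and "x \<in> R" "x \<in> R'"
  shows "R = R'"
proof -
  obtain m l where R: "R = half_open_cube (\<chi> i. of_int (m i) * 2 powi l) (2 powi l)"
    using assms(1) by (auto simp: dyadic_cubes_def)
  obtain m' l' where R': "R' = half_open_cube (\<chi> i. of_int (m' i) * 2 powi l') (2 powi l')"
    using assms(2) by (auto simp: dyadic_cubes_def)
  define s :: real where "s = 2 powi l"
  have s: "s > 0" "2 powi l' = s" using assms(3) by (auto simp: R R' s_def)
  have "m i = \<lfloor>x $ i / s\<rfloor>" "m' i = \<lfloor>x $ i / s\<rfloor>" for i
    using assms(4,5) s(1) unfolding R R' s(2) s_def[symmetric] half_open_cube_def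
    by (auto intro!: floor_unique[symmetric] simp: field_simps)
  then show ?thesis by (simp add: R R' s(2) s_def[symmetric])
qed

lemma dyadic_descendants_disjoint:
  assumes "C \<subseteq> dyadic_descendants m Q"
  shows "disjoint_family_on (\<lambda>R. R) C"
  unfolding disjoint_family_on_def
proof (intro ballI impI)
  fix R R' assume R: "R \<in> C" "R' \<in> C" "R \<noteq> R'"
  then have "R \<in> dyadic_descendants m Q" "R' \<in> dyadic_descendants m Q"
    using assms by auto
  then have "R \<in> dyadic_cubes" "R' \<in> dyadic_cubes" "side_length R = side_length R'"
    by (auto simp: dyadic_descendants_def)
  then show "R \<inter> R' = {}"
    using dyadic_cubes_same_size_eq R(3) by blast
qed

lemma measure_dyadic_descendant:
  fixes Q :: "(real ^ 'n) set"
  assumes "R \<in> dyadic_descendants j Q"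
  shows "measure lebesgue R = (side_length Q / 2 ^ j) ^ CARD('n)"
  using assms measure_dyadic_cube[of R] by (auto simp: dyadic_descendants_def)

lemma Union_dyadic_descendants_lmeasurable:
  assumes "Q \<in> dyadic_cubes" "C \<subseteq> dyadic_descendants m Q"
  shows "\<Union>C \<in> lmeasurable"
  using assms finite_subset[OF assms(2) finite_dyadic_descendants[OF assms(1)]]
  by (intro fmeasurable.finite_Union)
     (auto simp: dyadic_descendants_def intro: dyadic_cube_lmeasurable)

lemma dyadic_descendants_cover:
  assumes Q: "Q \<in> dyadic_cubes" and x: "x \<in> Q"
  shows "\<exists>R\<in>dyadic_descendants j Q. x \<in> R"
proof (induction j)
  case 0
  then show ?case using Q x by (auto simp: dyadic_descendants_def)
next
  case (Suc j)
  then obtain R where R: "R \<in> dyadic_descendants j Q" "x \<in> R" by auto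
  then obtain P where P: "P \<in> dyadic_children R" "x \<in> P"
    using dyadic_child_unique[of R x] by (metis (no_types, lifting) dyadic_descendants_def mem_Collect_eq)
  have "P \<in> dyadic_descendants (Suc j) Q"
    using P R by (auto simp: dyadic_descendants_def)
  with P show ?case by auto
qed

lemma dyadic_cube_nonempty:
  assumes "Q \<in> dyadic_cubes"
  shows "\<exists>x. x \<in> Q"
proof -
  obtain a s where "s > 0" "Q = half_open_cube a s" using assms by (rule dyadic_cubeE)
  then have "a \<in> Q" by (simp add: half_open_cube_def)
  then show ?thesis ..
qed

lemma dyadic_descendants_0:
  assumes Q: "Q \<in> dyadic_cubes"
  shows "dyadic_descendants 0 Q = {Q}"
proof -
  have "P = Q" if P: "P \<in> dyadic_descendants 0 Q" for P
    using dyadic_cube_nonempty[of P] dyadic_cubes_same_size_eq[of P Q] P Q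
    by (auto simp: dyadic_descendants_def)
  then show ?thesis using Q by (auto simp: dyadic_descendants_def)
qed

text \<open>Pick a point of \<open>P\<close>, the generation-\<open>j\<close> cube \<open>R\<close> containing it, and the child of \<open>R\<close> containing
  it; that child has the size of \<open>P\<close> and meets \<open>P\<close>, so it is \<open>P\<close>.\<close>

lemma dyadic_parent:
  assumes Q: "Q \<in> dyadic_cubes" and P: "P \<in> dyadic_descendants (Suc j) Q"
  shows "\<exists>R\<in>dyadic_descendants j Q. P \<in> dyadic_children R"
proof -
  obtain x where x: "x \<in> P" "x \<in> Q"
    using P dyadic_cube_nonempty by (auto simp: dyadic_descendants_def)
  then obtain R where R: "R \<in> dyadic_descendants j Q" "x \<in> R"
    using dyadic_descendants_cover[OF Q] by blast
  then obtain P' where P': "P' \<in> dyadic_children R" "x \<in> P'"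
    using dyadic_child_unique[of R x] by (metis (no_types, lifting) dyadic_descendants_def mem_Collect_eq)
  have "side_length P' = side_length P"
    using P P'(1) R(1) by (simp add: dyadic_descendants_def)
  then have "P' = P"
    using P P' x(1) by (intro dyadic_cubes_same_size_eq[of P' P x]) (auto simp: dyadic_descendants_def)
  then show ?thesis using P' R by blast
qed

section \<open>Averages along a dyadic chain\<close>

text \<open>The martingale difference of \<open>R\<close> is a step function on the children of \<open>R\<close>, which are
  pairwise disjoint.\<close>

lemma L2_norm_martingale_difference:
  assumes R: "R \<in> dyadic_cubes"
  shows "(L2_norm_on UNIV (martingale_difference R h))\<^sup>2 =
    (\<Sum>P\<in>dyadic_children R. (average h P - average h R)\<^sup>2 * measure lebesgue P)"
proof -
  have fin: "finite (dyadic_children R)" using R by (rule finite_dyadic_descendants)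
  have step: "(martingale_difference R h x)\<^sup>2 =
      (\<Sum>P\<in>dyadic_children R. (average h P - average h R)\<^sup>2 * indicator P x)" for x
  proof (cases "x \<in> R")
    case True
    then obtain P0 where P0: "P0 \<in> dyadic_children R" "x \<in> P0"
      and uniq: "\<And>P. P \<in> dyadic_children R \<Longrightarrow> x \<in> P \<Longrightarrow> P = P0"
      using dyadic_child_unique[OF R] by metis
    have "(\<Sum>P\<in>dyadic_children R. (average h P - average h R)\<^sup>2 * indicator P x)
      = (\<Sum>P\<in>dyadic_children R. if P = P0 then (average h P0 - average h R)\<^sup>2 else 0)"
    proof (rule sum.cong)
      fix P assume P: "P \<in> dyadic_children R"
      show "(average h P - average h R)\<^sup>2 * indicator P x =
          (if P = P0 then (average h P0 - average h R)\<^sup>2 else 0)"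
        using P0(2) uniq[OF P] by (cases "x \<in> P") auto
    qed simp
    then show ?thesis
      using P0 fin by (simp add: martingale_difference_child[OF R P0])
  next
    case False
    then have "P \<in> dyadic_children R \<Longrightarrow> x \<notin> P" for P
      by (auto simp: dyadic_descendants_def)
    with False show ?thesis by (simp add: martingale_difference_def)
  qed
  have P: "P \<in> lmeasurable" if "P \<in> dyadic_children R" for P
    using that by (auto simp: dyadic_descendants_def intro: dyadic_cube_lmeasurable)
  have "(LINT x:UNIV|lebesgue. (martingale_difference R h x)\<^sup>2) =
      (LINT x|lebesgue. (\<Sum>P\<in>dyadic_children R. (average h P - average h R)\<^sup>2 * indicator P x))"
    by (simp add: set_lebesgue_integral_def step)
  also have "\<dots> = (\<Sum>P\<in>dyadic_children R. (average h P - average h R)\<^sup>2 * measure lebesgue P)"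
    using P by (simp add: lmeasurable_iff_integrable)
  finally show ?thesis
    by (simp add: L2_norm_on_def sum_nonneg)
qed

text \<open>A single term of \<open>\<Delta>\<^sub>m\<^sup>h(Q)\<^sup>2\<close> already contains the square of the jump weighted by the measure of
  the child, and a child of generation at most \<open>m\<close> fills at least the fraction
  \<open>1 / 2 ^ (m * CARD('n))\<close> of \<open>Q\<close>.\<close>

lemma average_dyadic_child_bound:
  fixes Q :: "(real ^ 'n) set"
  assumes Q: "Q \<in> dyadic_cubes" and "j < m"
    and D: "Delta_squared m h Q \<le> \<delta> * side_length Q ^ CARD('n)"
    and R: "R \<in> dyadic_descendants j Q" and P: "P \<in> dyadic_children R"
  shows "\<bar>average h P - average h R\<bar> \<le> sqrt (\<delta> * 2 ^ (m * CARD('n)))"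
proof -
  let ?d = "(average h P - average h R)\<^sup>2" and ?s = "side_length Q ^ CARD('n)"
  have Rd: "R \<in> dyadic_cubes" using R by (simp add: dyadic_descendants_def)
  have s: "?s > 0" using side_length_pos[OF Q] by simp
  have mP: "measure lebesgue P = ?s / 2 ^ (Suc j * CARD('n))"
    using measure_dyadic_descendant[OF P] R
    by (simp add: dyadic_descendants_def power_divide power_mult_distrib power_add flip: power_mult)
  have "?s / 2 ^ (m * CARD('n)) \<le> measure lebesgue P"
    unfolding mP using s \<open>j < m\<close>
    by (intro divide_left_mono power_increasing mult_right_mono) auto
  then have "?d * (?s / 2 ^ (m * CARD('n))) \<le> ?d * measure lebesgue P"
    by (rule mult_left_mono) simp
  also have "\<dots> \<le> (L2_norm_on UNIV (martingale_difference R h))\<^sup>2"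
    unfolding L2_norm_martingale_difference[OF Rd]
    by (rule member_le_sum[OF P]) (auto intro: finite_dyadic_descendants Rd)
  also have "\<dots> \<le> (\<Sum>R\<in>dyadic_descendants j Q. (L2_norm_on UNIV (martingale_difference R h))\<^sup>2)"
    by (rule member_le_sum[OF R]) (auto intro: finite_dyadic_descendants Q)
  also have "\<dots> \<le> Delta_squared m h Q"
    unfolding Delta_squared_def using \<open>j < m\<close>
    by (intro member_le_sum[of j "{0..m}"]) (auto intro: sum_nonneg)
  also note D
  finally have "?d \<le> \<delta> * 2 ^ (m * CARD('n))"
    using s by (simp add: field_simps)
  then show ?thesis
    by (simp add: real_le_rsqrt)
qed

text \<open>The averages telescope along the chain of parents from \<open>P\<close> up to \<open>Q\<close>.\<close>

lemma average_dyadic_descendant_bound: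
  fixes Q :: "(real ^ 'n) set"
  assumes Q: "Q \<in> dyadic_cubes" and D: "Delta_squared m h Q \<le> \<delta> * side_length Q ^ CARD('n)"
    and "P \<in> dyadic_descendants j Q" "j \<le> m"
  shows "\<bar>average h P - average h Q\<bar> \<le> j * sqrt (\<delta> * 2 ^ (m * CARD('n)))"
  using assms(3,4)
proof (induction j arbitrary: P)
  case 0
  then have "P = Q" using dyadic_descendants_0[OF Q] by auto
  then show ?case by simp
next
  case (Suc j)
  obtain R where R: "R \<in> dyadic_descendants j Q" and P: "P \<in> dyadic_children R"
    using dyadic_parent[OF Q Suc.prems(1)] by auto
  have "\<bar>average h R - average h Q\<bar> \<le> j * sqrt (\<delta> * 2 ^ (m * CARD('n)))"
    using Suc.IH[OF R] Suc.prems by simp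
  moreover have "\<bar>average h P - average h R\<bar> \<le> sqrt (\<delta> * 2 ^ (m * CARD('n)))"
    using Suc.prems by (intro average_dyadic_child_bound[OF Q _ D R P]) auto
  moreover have "Suc j * sqrt (\<delta> * 2 ^ (m * CARD('n))) =
      j * sqrt (\<delta> * 2 ^ (m * CARD('n))) + sqrt (\<delta> * 2 ^ (m * CARD('n)))"
    by (simp add: distrib_right)
  ultimately show ?case by linarith
qed

section \<open>Approximation by unions of dyadic cubes\<close>

abbreviation unit_cube :: "(real ^ 'n) set" where
  "unit_cube \<equiv> half_open_cube 0 1"

lemma unit_cube_dyadic: "unit_cube \<in> dyadic_cubes"
  unfolding dyadic_cubes_def
  by (rule CollectI, rule exI[of _ "\<lambda>_. 0"], rule exI[of _ 0]) (simp add: zero_vec_def)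

lemma dist_half_open_cube_le:
  fixes x y a :: "real ^ 'n" and s :: real
  assumes "x \<in> half_open_cube a s" "y \<in> half_open_cube a s"
  shows "dist x y \<le> CARD('n) * s"
proof -
  have le: "\<bar>(x - y) $ i\<bar> \<le> s" for i
  proof -
    have "a $ i \<le> x $ i" "x $ i < a $ i + s" "a $ i \<le> y $ i" "y $ i < a $ i + s"
      using assms by (auto simp: half_open_cube_def)
    then show ?thesis by simp
  qed
  have "dist x y \<le> (\<Sum>i\<in>UNIV. \<bar>(x - y) $ i\<bar>)"
    unfolding dist_norm by (rule norm_le_l1_cart)
  also have "\<dots> \<le> CARD('n) * s"
    by (rule sum_bounded_above) (use le in auto)
  finally show ?thesis .
qed

text \<open>Squeeze \<open>E\<close> between a compact \<open>K\<close> and an open \<open>U\<close>. As soon as the diameter of the cubes is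
  below the distance from \<open>K\<close> to the complement of \<open>U\<close>, the cubes that meet \<open>K\<close> have a union between \<open>K\<close> and \<open>U\<close>.\<close>

lemma pixelation:
  fixes E Q :: "(real ^ 'n) set"
  assumes Q: "Q \<in> dyadic_cubes" and E: "E \<in> sets lebesgue" "E \<subseteq> Q" and "\<eta> > 0"
  shows "\<exists>m0. \<forall>m\<ge>m0. \<exists>C\<subseteq>dyadic_descendants m Q. measure lebesgue (sym_diff E (\<Union>C)) < \<eta>"
proof -
  have \<eta>: "\<eta> / 2 > 0" using \<open>\<eta> > 0\<close> by simp
  obtain K where K: "closed K" "K \<subseteq> E" "E - K \<in> lmeasurable"
      "emeasure lebesgue (E - K) < ennreal (\<eta> / 2)"
    using sets_lebesgue_inner_closed[OF E(1) \<eta>] .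
  obtain U where U: "open U" "E \<subseteq> U" "U - E \<in> lmeasurable"
      "emeasure lebesgue (U - E) < ennreal (\<eta> / 2)"
    using sets_lebesgue_outer_open[OF E(1) \<eta>] .
  have small: "measure lebesgue (E - K) < \<eta> / 2" "measure lebesgue (U - E) < \<eta> / 2"
    using K U \<eta> by (simp_all add: emeasure_eq_measure2 ennreal_less_iff)
  obtain a s where s: "s > 0" and Qas: "Q = half_open_cube a s"
    using Q by (rule dyadic_cubeE)
  have "Q \<subseteq> cbox a (a + (\<chi> i. s))"
    by (auto simp: Qas half_open_cube_def mem_box_cart less_imp_le)
  then have "bounded K"
    using K(2) E(2) bounded_subset[OF bounded_cbox] by (metis subset_trans)
  then have "compact K" using K(1) by (simp add: compact_eq_bounded_closed)
  then obtain d where d: "d > 0" "\<And>x y. x \<in> K \<Longrightarrow> y \<notin> U \<Longrightarrow> d \<le> dist x y"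
  proof -
    have "K \<inter> - U = {}" using U(2) K(2) by auto
    then show ?thesis
      using separate_compact_closed[OF \<open>compact K\<close>, of "- U"] U(1) that
      by (auto simp: closed_Compl)
  qed
  obtain m0 :: nat where m0: "CARD('n) * s / d < 2 ^ m0"
    using real_arch_pow[of 2] by auto
  show ?thesis
  proof (intro exI[of _ m0] allI impI)
    fix m assume "m0 \<le> m"
    then have "(2::real) ^ m0 \<le> 2 ^ m" by (rule power_increasing) simp
    then have "CARD('n) * s / d < 2 ^ m" using m0 by linarith
    then have fine: "CARD('n) * (s / 2 ^ m) < d"
      using d(1) by (simp add: divide_less_eq mult.commute)
    define C where "C = {R \<in> dyadic_descendants m Q. R \<inter> K \<noteq> {}}"
    have C: "C \<subseteq> dyadic_descendants m Q" by (auto simp: C_def)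
    have "K \<subseteq> \<Union>C"
      using dyadic_descendants_cover[OF Q] K(2) E(2) by (fastforce simp: C_def)
    moreover have "\<Union>C \<subseteq> U"
    proof
      fix y assume "y \<in> \<Union>C"
      then obtain R x where R: "R \<in> dyadic_descendants m Q" "y \<in> R" "x \<in> R" and x: "x \<in> K"
        by (auto simp: C_def)
      then obtain b t where t: "t > 0" "R = half_open_cube b t"
        by (auto simp: dyadic_descendants_def elim: dyadic_cubeE)
      then have "t = s / 2 ^ m" using R s by (simp add: dyadic_descendants_def Qas)
      then have "dist x y < d"
        using dist_half_open_cube_le[of x b t y] R t fine by simp
      then show "y \<in> U" using d(2)[OF x, of y] by auto
    qed
    ultimately have sub: "sym_diff E (\<Union>C) \<subseteq> (E - K) \<union> (U - E)" by auto
    have "measure lebesgue (sym_diff E (\<Union>C)) \<le> measure lebesgue ((E - K) \<union> (U - E))"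
      using K U E Union_dyadic_descendants_lmeasurable[OF Q C]
      by (intro measure_mono_fmeasurable sub) auto
    also have "\<dots> \<le> measure lebesgue (E - K) + measure lebesgue (U - E)"
      using K U by (intro measure_Un_le) auto
    also have "\<dots> < \<eta>" using small by simp
    finally show "\<exists>C\<subseteq>dyadic_descendants m Q. measure lebesgue (sym_diff E (\<Union>C)) < \<eta>"
      using C by blast
  qed
qed

text \<open>The ratio condition is multiplicative; it gives an additive bound because \<open>Lo\<close> lies in the unit
  cube. It also rules out an infinite measure of \<open>U\<close>, for which the real-valued \<open>measure\<close> and with it
  the quotient would be \<open>0\<close>.\<close>

lemma measure_sandwich_gap:
  assumes "Lo \<in> sets lebesgue" "U \<in> sets lebesgue" "Lo \<subseteq> U"
    and "measure lebesgue Lo \<le> 1" and "0 < \<epsilon>" "\<epsilon> < 1/2"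
    and ratio: "measure lebesgue Lo / measure lebesgue U \<ge> 1 - \<epsilon>"
  shows "U - Lo \<in> lmeasurable" "measure lebesgue (U - Lo) \<le> 2 * \<epsilon>"
proof -
  have nz: "measure lebesgue U \<noteq> 0" using ratio assms by auto
  then have pos: "measure lebesgue U > 0" by (simp add: zero_less_measure_iff)
  have U: "U \<in> lmeasurable"
    using assms(2) measure_zero_top[of lebesgue U] nz
    by (intro fmeasurableI) (auto simp only: infinity_ennreal_def less_top[symmetric])
  then have Lo: "Lo \<in> lmeasurable" using assms by (blast intro: fmeasurableI2)
  show "U - Lo \<in> lmeasurable" using U Lo by (rule fmeasurable.Diff)
  have le: "(1 - \<epsilon>) * measure lebesgue U \<le> measure lebesgue Lo"
    using ratio pos by (simp add: field_simps)
  have "1/2 * measure lebesgue U \<le> (1 - \<epsilon>) * measure lebesgue U"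
    using assms pos by (intro mult_right_mono) auto
  then have "measure lebesgue U \<le> 2" using le assms by simp
  then have "\<epsilon> * measure lebesgue U \<le> \<epsilon> * 2" using assms by (intro mult_left_mono) auto
  moreover have "measure lebesgue (U - Lo) = measure lebesgue U - measure lebesgue Lo"
    using assms U Lo by (intro measurable_measure_Diff) auto
  ultimately show "measure lebesgue (U - Lo) \<le> 2 * \<epsilon>"
    using le by (simp add: algebra_simps)
qed

text \<open>Uniformity in \<open>E\<close> comes from compactness. If each generation \<open>m\<close> fails for some set \<open>F m\<close>, then
  along a subsequence the \<open>F m\<close> are close in measure to one fixed set \<open>Lo\<close>; a fine approximation of
  \<open>Lo\<close> then approximates \<open>F m\<close> as well, for some large \<open>m\<close>.

  Members of the family lie in the closed unit cube, and the dyadic cubes fill the half-open one.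
  Intersecting with the latter discards a null set.\<close>

lemma sandwichable_uniform_pixelation:
  fixes \<F> :: "(real ^ 'n) set set"
  assumes sw: "sandwichable \<F>" and "\<eta> > 0"
  shows "\<exists>m. \<forall>E\<in>\<F>. \<exists>C\<subseteq>dyadic_descendants m unit_cube.
    measure lebesgue (sym_diff (E \<inter> unit_cube) (\<Union>C)) < \<eta>"
proof (rule ccontr)
  assume "\<not> ?thesis"
  then have "\<forall>m. \<exists>E. E \<in> \<F> \<and> (\<forall>C\<subseteq>dyadic_descendants m unit_cube.
      \<not> measure lebesgue (sym_diff (E \<inter> unit_cube) (\<Union>C)) < \<eta>)"
    by blast
  then obtain F where F: "\<And>m. F m \<in> \<F>"
    and bad: "\<And>m C. C \<subseteq> dyadic_descendants m unit_cube \<Longrightarrow>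
      \<not> measure lebesgue (sym_diff (F m \<inter> unit_cube) (\<Union>C)) < \<eta>"
    using choice[of "\<lambda>m E. E \<in> \<F> \<and> (\<forall>C\<subseteq>dyadic_descendants m unit_cube.
      \<not> measure lebesgue (sym_diff (E \<inter> unit_cube) (\<Union>C)) < \<eta>)"] by blast
  \<comment> \<open>The gap \<open>2 * \<epsilon>\<close> may use half of \<open>\<eta>\<close>; the other half is left for the approximation of \<open>Lo\<close>.
    The bound \<open>1/4\<close> keeps \<open>\<epsilon>\<close> in the range in which the sandwich is available.\<close>
  define \<epsilon> where "\<epsilon> = min (1/4) (\<eta>/4)"
  have \<epsilon>: "\<epsilon> \<in> {0<..<1/2}" "2 * \<epsilon> \<le> \<eta> / 2" using \<open>\<eta> > 0\<close> by (auto simp: \<epsilon>_def)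
  have \<F>: "E \<in> sets lebesgue" "E \<subseteq> cbox 0 1" if "E \<in> \<F>" for E
    using sw that by (auto simp: sandwichable_def)
  have "range F \<subseteq> \<F>" using F by auto
  then obtain r Lo U k0 where r: "strict_mono (r :: nat \<Rightarrow> nat)"
    and meas: "Lo \<in> sets lebesgue" "U \<in> sets lebesgue"
    and sub: "\<And>k. k \<ge> k0 \<Longrightarrow> Lo \<subseteq> F (r k)" "\<And>k. k \<ge> k0 \<Longrightarrow> F (r k) \<subseteq> U"
    and ratio: "measure lebesgue Lo / measure lebesgue U \<ge> 1 - \<epsilon>"
    using sw \<epsilon>(1) unfolding sandwichable_def by metis
  have "Lo \<subseteq> cbox 0 1" using sub(1)[of k0] \<F>(2)[OF F] by blast
  then have "measure lebesgue Lo \<le> measure lebesgue (cbox 0 (1 :: real ^ 'n))"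
    using meas by (intro measure_mono_fmeasurable) auto
  also have "\<dots> = 1"
    using content_cbox_cart[of 0 "1 :: real ^ 'n"] by (simp add: interval_ne_empty_cart)
  finally have Lo1: "measure lebesgue Lo \<le> 1" .
  have "Lo \<subseteq> U" using sub[of k0] by auto
  then have gap: "U - Lo \<in> lmeasurable" "measure lebesgue (U - Lo) \<le> 2 * \<epsilon>"
    using measure_sandwich_gap[OF meas _ Lo1 _ _ ratio] \<epsilon> by auto
  have unit: "unit_cube \<in> lmeasurable" by (simp add: half_open_cube_lmeasurable)
  have Lou: "Lo \<inter> unit_cube \<in> lmeasurable"
    using meas unit by (blast intro: fmeasurableI2)
  obtain m0 where m0: "\<And>m. m \<ge> m0 \<Longrightarrow> \<exists>C\<subseteq>dyadic_descendants m unit_cube.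
      measure lebesgue (sym_diff (Lo \<inter> unit_cube) (\<Union>C)) < \<eta> / 2"
    using pixelation[OF unit_cube_dyadic, of "Lo \<inter> unit_cube" "\<eta> / 2"] Lou \<open>\<eta> > 0\<close>
    by auto
  \<comment> \<open>A strictly increasing \<open>r\<close> satisfies \<open>r k \<ge> k\<close>, so \<open>r k\<close> is at least \<open>m0\<close> too.\<close>
  define k where "k = max k0 m0"
  have "r k \<ge> m0" using seq_suble[OF r, of k] by (simp add: k_def)
  then obtain C where C: "C \<subseteq> dyadic_descendants (r k) unit_cube"
    and less: "measure lebesgue (sym_diff (Lo \<inter> unit_cube) (\<Union>C)) < \<eta> / 2"
    using m0 by blast
  have UC: "\<Union>C \<in> lmeasurable"
    by (rule Union_dyadic_descendants_lmeasurable[OF unit_cube_dyadic C])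
  have "sym_diff (F (r k) \<inter> unit_cube) (\<Union>C) \<subseteq> (U - Lo) \<union> sym_diff (Lo \<inter> unit_cube) (\<Union>C)"
    using sub[of k] C by (auto simp: k_def dyadic_descendants_def)
  then have "measure lebesgue (sym_diff (F (r k) \<inter> unit_cube) (\<Union>C)) \<le>
      measure lebesgue ((U - Lo) \<union> sym_diff (Lo \<inter> unit_cube) (\<Union>C))"
    using \<F>(1)[OF F, of "r k"] unit UC gap Lou by (intro measure_mono_fmeasurable) auto
  also have "\<dots> \<le> measure lebesgue (U - Lo) + measure lebesgue (sym_diff (Lo \<inter> unit_cube) (\<Union>C))"
    using gap UC Lou by (intro measure_Un_le) auto
  also have "\<dots> < \<eta>" using gap(2) less \<epsilon>(2) by simp
  finally show False using bad[OF C] by simp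
qed

section \<open>Transport from the unit cube to an arbitrary dyadic cube\<close>

lemma cube_map_half_open_cube:
  fixes a b :: "real ^ 'n"
  assumes "s > 0"
  shows "cube_map (half_open_cube a s) ` half_open_cube b t = half_open_cube (a + s *\<^sub>R b) (s * t)"
proof -
  let ?f = "\<lambda>x. a + s *\<^sub>R x"
  have map: "cube_map (half_open_cube a s) = ?f"
    using assms by (simp add: cube_map_def fun_eq_iff)
  have inv: "y = ?f ((1 / s) *\<^sub>R (y - a))" for y using assms by simp
  have iff: "?f x \<in> half_open_cube (a + s *\<^sub>R b) (s * t) \<longleftrightarrow> x \<in> half_open_cube b t" for x
    using assms by (simp add: half_open_cube_def flip: distrib_left)
  show ?thesis unfolding map
    using inv iff by (metis (no_types, lifting) image_iff set_eqI)
qed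

lemma inj_cube_map:
  assumes "Q \<in> dyadic_cubes"
  shows "inj (cube_map Q)"
  using side_length_pos[OF assms] by (auto simp: inj_def cube_map_def)

lemma cube_map_unit_cube:
  assumes "Q \<in> dyadic_cubes"
  shows "cube_map Q ` unit_cube = Q"
proof -
  obtain a s where "s > 0" "Q = half_open_cube a s" using assms by (rule dyadic_cubeE)
  then show ?thesis using cube_map_half_open_cube[of s a 0 1] by simp
qed

text \<open>A generation-\<open>j\<close> cube of the unit cube has side \<open>2 powi (- j)\<close>. If \<open>Q\<close> has side \<open>2 powi q\<close> and
  index \<open>p\<close>, the cube with index \<open>m\<close> goes to the cube of side \<open>2 powi (q - j)\<close> with index
  \<open>p * 2 ^ j + m\<close>, which is an integer because \<open>j\<close> is nonnegative.\<close>

lemma cube_map_dyadic_descendant: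
  fixes Q R :: "(real ^ 'n) set"
  assumes Q: "Q \<in> dyadic_cubes" and R: "R \<in> dyadic_descendants j unit_cube"
  shows "cube_map Q ` R \<in> dyadic_descendants j Q"
proof -
  obtain p q where Qpq: "Q = half_open_cube (\<chi> i. of_int (p i) * 2 powi q) (2 powi q)"
    using Q by (auto simp: dyadic_cubes_def)
  obtain m l where Rml: "R = half_open_cube (\<chi> i. of_int (m i) * 2 powi l) (2 powi l)"
    using R by (auto simp: dyadic_descendants_def dyadic_cubes_def)
  have l: "2 powi l = 1 / (2 :: real) ^ j"
    using R by (simp add: dyadic_descendants_def Rml)
  have s: "2 powi (q - int j) = 2 powi q / (2 :: real) ^ j"
    by (simp add: power_int_diff)
  have "cube_map Q ` R = half_open_cube
      ((\<chi> i. of_int (p i) * 2 powi q) + 2 powi q *\<^sub>R (\<chi> i. of_int (m i) * 2 powi l))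
      (2 powi q * 2 powi l)"
    unfolding Qpq Rml by (rule cube_map_half_open_cube) simp
  also have "\<dots> = half_open_cube (\<chi> i. of_int (p i * 2 ^ j + m i) * 2 powi (q - int j)) (2 powi (q - int j))"
    unfolding l s by (intro arg_cong2[of _ _ _ _ half_open_cube]) (auto simp: vec_eq_iff field_simps)
  finally have eq: "cube_map Q ` R = \<dots>" .
  have "cube_map Q ` R \<in> dyadic_cubes"
    unfolding eq dyadic_cubes_def
    by (rule CollectI, rule exI[of _ "\<lambda>i. p i * 2 ^ j + m i"], rule exI[of _ "q - int j"]) simp
  moreover have "side_length (cube_map Q ` R) = side_length Q / 2 ^ j"
    unfolding eq by (simp add: Qpq s)
  moreover have "cube_map Q ` R \<subseteq> Q"
    using R cube_map_unit_cube[OF Q] by (auto simp: dyadic_descendants_def)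
  ultimately show ?thesis by (simp add: dyadic_descendants_def)
qed

lemma
  fixes Q :: "(real ^ 'n) set"
  assumes Q: "Q \<in> dyadic_cubes"
  shows measure_cube_map:
      "measure lebesgue (cube_map Q ` S) = side_length Q ^ CARD('n) * measure lebesgue S"
    and negligible_cube_map: "negligible S \<Longrightarrow> negligible (cube_map Q ` S)"
    and sets_cube_map: "S \<in> sets lebesgue \<Longrightarrow> cube_map Q ` S \<in> sets lebesgue"
proof -
  let ?a = "cube_corner Q" and ?s = "side_length Q"
  have s: "?s > 0" using Q by (rule side_length_pos)
  have map: "cube_map Q = (\<lambda>x. ?s *\<^sub>R x + ?a)" by (auto simp: cube_map_def)
  show "measure lebesgue (cube_map Q ` S) = ?s ^ CARD('n) * measure lebesgue S"
    using measure_lebesgue_affine[of ?s ?a S] s by (simp add: map)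
  show sets: "cube_map Q ` S \<in> sets lebesgue" if S: "S \<in> sets lebesgue" for S
  proof -
    have "(*\<^sub>R) (1 / ?s) -` S \<inter> space lebesgue \<in> sets lebesgue"
      using S by (intro measurable_sets[OF lebesgue_measurable_scaling])
    moreover have "(*\<^sub>R) (1 / ?s) -` S \<inter> space lebesgue = (*\<^sub>R) ?s ` S"
      using s by (auto simp: image_iff) 
        (metis divide_self less_irrefl scaleR_one scaleR_scaleR times_divide_eq_right
          mult.right_neutral)
    ultimately have "(\<lambda>x. ?a + x) ` ((*\<^sub>R) ?s ` S) \<in> sets lebesgue"
      using lebesgue_sets_translation by metis
    moreover have "(\<lambda>x. ?a + x) ` ((*\<^sub>R) ?s ` S) = cube_map Q ` S"
      by (auto simp: cube_map_def)
    ultimately show ?thesis by simp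
  qed
  show "negligible (cube_map Q ` S)" if "negligible S"
    using that sets[of S] emeasure_lebesgue_affine[of ?s ?a S]
    by (auto simp: negligible_iff_null_sets map null_sets_def)
qed

section \<open>Integrals of the deviation from the average\<close>

lemma square_integrable_set_integrable:
  assumes h: "square_integrable h" and S: "S \<in> lmeasurable"
  shows "set_integrable lebesgue S h" "set_integrable lebesgue S (\<lambda>x. (h x)\<^sup>2)"
proof -
  have m [measurable]: "h \<in> borel_measurable lebesgue" and i: "integrable lebesgue (\<lambda>x. (h x)\<^sup>2)"
    using h by (auto simp: square_integrable_def)
  have S': "S \<in> sets lebesgue" using S by simp
  show sq: "set_integrable lebesgue S (\<lambda>x. (h x)\<^sup>2)"
    unfolding set_integrable_def using i S' by (intro integrable_mult_indicator)
  have one: "set_integrable lebesgue S (\<lambda>x. 1 :: real)"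
    using S by (simp add: set_integrable_def lmeasurable_iff_integrable)
  show "set_integrable lebesgue S h"
  proof (rule set_integrable_bound[OF set_integral_add(1)[OF one sq]])
    show "set_borel_measurable lebesgue S h"
      unfolding set_borel_measurable_def using S' by measurable
    have "\<bar>y\<bar> \<le> 1 + y\<^sup>2" for y :: real
      using sum_power2_ge_zero[of "\<bar>y\<bar> - 1/2" 0] by (simp add: power2_eq_square algebra_simps)
    then show "AE x in lebesgue. x \<in> S \<longrightarrow> norm (h x) \<le> norm (1 + (h x)\<^sup>2)"
      by simp
  qed
qed

lemma set_integral_const:
  fixes S :: "(real ^ 'n) set"
  assumes "S \<in> lmeasurable"
  shows "(LINT x:S|lebesgue. c) = c * measure lebesgue S" "set_integrable lebesgue S (\<lambda>x. c :: real)"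
  using assms by (auto simp: set_lebesgue_integral_def set_integrable_def fmeasurable_def)

lemma set_integral_deviation_descendants:
  fixes Q :: "(real ^ 'n) set"
  assumes h: "square_integrable h" and Q: "Q \<in> dyadic_cubes"
    and C: "C \<subseteq> dyadic_descendants m Q"
    and \<tau>: "\<And>R. R \<in> C \<Longrightarrow> \<bar>average h R - a\<bar> \<le> \<tau>"
  shows "\<bar>LINT x:\<Union>C|lebesgue. h x - a\<bar> \<le> \<tau> * measure lebesgue (\<Union>C)"
proof -
  have fin: "finite C" using C finite_dyadic_descendants[OF Q] by (rule finite_subset)
  have R: "R \<in> dyadic_cubes" "R \<in> lmeasurable" if "R \<in> C" for R
    using that C by (auto simp: dyadic_descendants_def intro: dyadic_cube_lmeasurable)
  have int: "set_integrable lebesgue R (\<lambda>x. h x - a)" if "R \<in> C" for R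
    using R[OF that] by (intro set_integral_diff square_integrable_set_integrable h set_integral_const)
  have val: "(LINT x:R|lebesgue. h x - a) = (average h R - a) * measure lebesgue R" if "R \<in> C" for R
  proof -
    have pos: "measure lebesgue R > 0"
      using R(1)[OF that] by (rule measure_dyadic_cube_pos)
    have "(LINT x:R|lebesgue. h x - a) = (LINT x:R|lebesgue. h x) - a * measure lebesgue R"
      using R[OF that] h by (simp add: set_integral_const set_integral_diff square_integrable_set_integrable)
    moreover have "(LINT x:R|lebesgue. h x) = average h R * measure lebesgue R"
      using pos by (simp add: average_def)
    ultimately show ?thesis by (simp add: left_diff_distrib)
  qed
  have "(LINT x:\<Union>C|lebesgue. h x - a) = (LINT x:(\<Union>R\<in>C. R)|lebesgue. h x - a)" by simp
  also have "\<dots> = (\<Sum>R\<in>C. LINT x:R|lebesgue. h x - a)"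
    using fin R int dyadic_descendants_disjoint[OF C] by (intro set_integral_finite_Union) auto
  also have "\<bar>\<dots>\<bar> \<le> (\<Sum>R\<in>C. \<bar>LINT x:R|lebesgue. h x - a\<bar>)" by (rule sum_abs)
  also have "\<dots> \<le> (\<Sum>R\<in>C. \<tau> * measure lebesgue R)"
    using \<tau> by (intro sum_mono) (simp add: val abs_mult mult_right_mono)
  also have "\<dots> = \<tau> * (\<Sum>R\<in>C. measure lebesgue R)" by (simp add: sum_distrib_left)
  also have "(\<Sum>R\<in>C. measure lebesgue R) = measure lebesgue (\<Union>R\<in>C. R)"
    using fin R dyadic_descendants_disjoint[OF C]
    by (intro measure_finite_Union[symmetric])
      (auto simp: fmeasurable_def less_top simp del: emeasure_completion)
  finally show ?thesis by simp
qed

text \<open>The left side is the right side minus the square of the average times the measure of \<open>Q\<close>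
  (variance is at most second moment).\<close>

lemma set_integral_sq_deviation_le:
  fixes Q :: "(real ^ 'n) set"
  assumes h: "square_integrable h" and Q: "Q \<in> dyadic_cubes"
  shows "(LINT x:Q|lebesgue. (h x - average h Q)\<^sup>2) \<le> (LINT x:Q|lebesgue. (h x)\<^sup>2)"
proof -
  let ?a = "average h Q"
  have Qm: "Q \<in> lmeasurable" using Q by (rule dyadic_cube_lmeasurable)
  have pos: "measure lebesgue Q > 0" using Q by (rule measure_dyadic_cube_pos)
  note int = square_integrable_set_integrable[OF h Qm] set_integral_const(2)[OF Qm]
  have "(LINT x:Q|lebesgue. (h x - ?a)\<^sup>2) = (LINT x:Q|lebesgue. ((h x)\<^sup>2 - 2 * ?a * h x) + ?a\<^sup>2)"
    by (simp add: power2_diff algebra_simps)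
  also have "\<dots> = (LINT x:Q|lebesgue. (h x)\<^sup>2) - 2 * ?a * (LINT x:Q|lebesgue. h x) + ?a\<^sup>2 * measure lebesgue Q"
    using int Qm by (simp add: set_integral_add set_integral_diff set_integral_const)
  also have "(LINT x:Q|lebesgue. h x) = ?a * measure lebesgue Q"
    using pos by (simp add: average_def)
  finally have "(LINT x:Q|lebesgue. (h x - ?a)\<^sup>2) =
      (LINT x:Q|lebesgue. (h x)\<^sup>2) - ?a\<^sup>2 * measure lebesgue Q"
    by (simp add: power2_eq_square)
  then show ?thesis by simp
qed

text \<open>A Cauchy--Schwarz estimate in additive form: integrate \<open>\<bar>y\<bar> \<le> y\<^sup>2 / (2 * t) + t / 2\<close>. The parameter
  \<open>t\<close> balances a bounded second moment against a small measure.\<close>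

lemma set_integral_abs_le_Young:
  fixes f :: "real ^ 'n \<Rightarrow> real"
  assumes f: "set_integrable lebesgue Q f" "set_integrable lebesgue Q (\<lambda>x. (f x)\<^sup>2)"
    and S: "S \<in> lmeasurable" "S \<subseteq> Q" and "t > 0"
  shows "(LINT x:S|lebesgue. \<bar>f x\<bar>) \<le>
    (LINT x:Q|lebesgue. (f x)\<^sup>2) / (2 * t) + t / 2 * measure lebesgue S"
proof -
  have fS: "set_integrable lebesgue S f" "set_integrable lebesgue S (\<lambda>x. (f x)\<^sup>2)"
    using f S by (auto intro: set_integrable_subset)
  have young: "\<bar>y\<bar> \<le> y\<^sup>2 / (2 * t) + t / 2" for y
    using zero_le_power2[of "\<bar>y\<bar> - t"] \<open>t > 0\<close> by (simp add: field_simps power2_eq_square)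
  have "(LINT x:S|lebesgue. \<bar>f x\<bar>) \<le> (LINT x:S|lebesgue. (f x)\<^sup>2 / (2 * t) + t / 2)"
    using fS S by (intro set_integral_mono young set_integrable_abs set_integral_add
        set_integrable_divide set_integral_const)
  also have "\<dots> = (LINT x:S|lebesgue. (f x)\<^sup>2) / (2 * t) + t / 2 * measure lebesgue S"
    using fS S by (simp add: set_integral_add set_integrable_divide set_integral_const)
  also have "(LINT x:S|lebesgue. (f x)\<^sup>2) \<le> (LINT x:Q|lebesgue. (f x)\<^sup>2)"
    unfolding set_lebesgue_integral_def
    using fS f S by (intro integral_mono) (auto simp: set_integrable_def split: split_indicator)
  finally show ?thesis using \<open>t > 0\<close> by (simp add: divide_right_mono)
qed

text \<open>Writing \<open>A = \<Union>C\<close> and \<open>f\<close> for the deviation from the average, the integrals of \<open>f\<close> over \<open>E\<close> and \<open>A\<close>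
  differ by at most the integral of \<open>\<bar>f\<bar>\<close> over the symmetric difference.\<close>

lemma set_integral_deviation:
  fixes Q :: "(real ^ 'n) set"
  assumes h: "square_integrable h" and Q: "Q \<in> dyadic_cubes"
    and C: "C \<subseteq> dyadic_descendants m Q"
    and \<tau>: "\<And>R. R \<in> C \<Longrightarrow> \<bar>average h R - average h Q\<bar> \<le> \<tau>" "\<tau> \<ge> 0"
    and E: "E \<in> sets lebesgue" "E \<subseteq> Q" and "t > 0"
  shows "\<bar>(LINT x:E|lebesgue. h x) - average h Q * measure lebesgue E\<bar> \<le>
    \<tau> * measure lebesgue Q + (LINT x:Q|lebesgue. (h x)\<^sup>2) / (2 * t)
      + t / 2 * measure lebesgue (sym_diff E (\<Union>C))"
proof -
  define f where "f = (\<lambda>x. h x - average h Q)"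
  define A where "A = \<Union>C"
  have A: "A \<in> lmeasurable" "A \<subseteq> Q"
    using Union_dyadic_descendants_lmeasurable[OF Q C] C
    by (auto simp: A_def dyadic_descendants_def)
  have Qm: "Q \<in> lmeasurable" using Q by (rule dyadic_cube_lmeasurable)
  have Em: "E \<in> lmeasurable" using fmeasurableI2[OF Qm E(2,1)] .
  note int = square_integrable_set_integrable[OF h Qm] set_integral_const(2)[OF Qm]
  have f: "set_integrable lebesgue Q f"
    unfolding f_def using int by (intro set_integral_diff)
  have "set_integrable lebesgue Q (\<lambda>x. ((h x)\<^sup>2 - 2 * average h Q * h x) + (average h Q)\<^sup>2)"
    using int by (intro set_integral_diff set_integral_add) auto
  then have f2: "set_integrable lebesgue Q (\<lambda>x. (f x)\<^sup>2)"
    by (simp add: f_def power2_diff algebra_simps)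
  have fS: "set_integrable lebesgue S f" if "S \<in> sets lebesgue" "S \<subseteq> Q" for S
    using f that by (rule set_integrable_subset)
  let ?I = "\<lambda>S. LINT x:S|lebesgue. f x" and ?J = "\<lambda>S. LINT x:S|lebesgue. \<bar>f x\<bar>"
  have split: "?I S = ?I (S \<inter> T) + ?I (S - T)" if "S \<in> sets lebesgue" "S \<subseteq> Q" "T \<in> sets lebesgue" for S T
    using that set_integral_Un[of "S \<inter> T" "S - T" lebesgue f]
    by (simp add: Int_Diff_Un Int_Diff_disjoint)
      (meson fS Diff_subset Int_lower1 sets.Diff sets.Int subset_trans)
  have abs: "\<bar>?I S\<bar> \<le> ?J S" for S
    using integral_abs_bound[of lebesgue "\<lambda>x. indicator S x * f x"]
    by (simp add: set_lebesgue_integral_def abs_mult)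
  have J: "?J (sym_diff E A) = ?J (E - A) + ?J (A - E)"
    using E A by (intro set_integral_Un set_integrable_abs fS) auto
  have "?I E = ?I A + ?I (E - A) - ?I (A - E)"
    using split[of E A] split[of A E] E A by (simp add: Int_commute)
  then have "\<bar>?I E\<bar> \<le> \<bar>?I A\<bar> + ?J (sym_diff E A)"
    using abs[of "E - A"] abs[of "A - E"] J by linarith
  also have "\<bar>?I A\<bar> \<le> \<tau> * measure lebesgue A"
    unfolding f_def A_def by (rule set_integral_deviation_descendants[OF h Q C \<tau>(1)])
  also have "\<dots> \<le> \<tau> * measure lebesgue Q"
    using A Qm \<tau>(2) by (intro mult_left_mono measure_mono_fmeasurable) auto
  also have "?J (sym_diff E A) \<le> (LINT x:Q|lebesgue. (f x)\<^sup>2) / (2 * t) + t / 2 * measure lebesgue (sym_diff E A)"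
    using Em E A \<open>t > 0\<close> by (intro set_integral_abs_le_Young f f2) auto
  also have "(LINT x:Q|lebesgue. (f x)\<^sup>2) / (2 * t) \<le> (LINT x:Q|lebesgue. (h x)\<^sup>2) / (2 * t)"
    unfolding f_def using \<open>t > 0\<close>
    by (intro divide_right_mono set_integral_sq_deviation_le[OF h Q]) simp
  also have "?I E = (LINT x:E|lebesgue. h x) - average h Q * measure lebesgue E"
    unfolding f_def using Em h
    by (simp add: set_integral_diff set_integral_const square_integrable_set_integrable)
  finally show ?thesis by (simp add: A_def)
qed

section \<open>Averages over rescaled sandwichable sets\<close>

theorem lemma5p11:
  fixes L :: real and \<E> :: "real \<Rightarrow> (real ^ 'n) set set"
  assumes "L \<ge> 1"
    and "sandwichable (\<E> L)"
  shows "\<forall>\<epsilon>>0. \<forall>M>0. \<exists>(k :: nat) (\<delta> :: real). \<delta> > 0 \<and>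
    (\<forall>(h :: real ^ 'n \<Rightarrow> real) Q.
       square_integrable h \<longrightarrow> Q \<in> dyadic_cubes \<longrightarrow>
       (AE x in lebesgue. h x \<ge> 0) \<longrightarrow>
       (L2_norm_on Q h)\<^sup>2 \<le> M * side_length Q ^ CARD('n) \<longrightarrow>
       Delta_squared k h Q \<le> \<delta> * side_length Q ^ CARD('n) \<longrightarrow>
       (\<forall>E \<in> rescaled_family (\<E> L) Q.
          \<bar>(LINT x:E|lebesgue. h x) / measure lebesgue E
            - (LINT x:Q|lebesgue. h x) / measure lebesgue Q\<bar> \<le> \<epsilon>))"
proof (intro allI impI)
  fix \<epsilon> M :: real assume "\<epsilon> > 0" "M > 0"
  obtain c where c: "c > 0" "\<And>E. E \<in> \<E> L \<Longrightarrow> measure lebesgue E \<ge> c"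
    using assms(2) by (auto simp: sandwichable_def)
  have \<E>: "E \<in> sets lebesgue" "E \<subseteq> cbox 0 1" if "E \<in> \<E> L" for E
    using assms(2) that by (auto simp: sandwichable_def)
  \<comment> \<open>Up to the factor given by the measure of \<open>Q\<close>, the error has three parts: \<open>\<tau>\<close>, \<open>M / (2 * t)\<close> and
    \<open>t / 2 * \<eta>\<close>. They become \<open>\<epsilon> * c / 2\<close>, \<open>\<epsilon> * c / 4\<close> and \<open>\<epsilon> * c / 4\<close>, and the factor \<open>c\<close> is absorbed
    on division by the measure of \<open>E\<close>.\<close>
  define t where "t = 2 * M / (\<epsilon> * c)"
  define \<eta> where "\<eta> = \<epsilon> * c / (2 * t)"
  have "t > 0" "\<eta> > 0" using \<open>\<epsilon> > 0\<close> \<open>M > 0\<close> c(1) by (auto simp: t_def \<eta>_def)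
  obtain m where m: "\<And>E. E \<in> \<E> L \<Longrightarrow> \<exists>C\<subseteq>dyadic_descendants m unit_cube.
      measure lebesgue (sym_diff (E \<inter> unit_cube) (\<Union>C)) < \<eta>"
    using sandwichable_uniform_pixelation[OF assms(2) \<open>\<eta> > 0\<close>] by auto
  define \<tau> where "\<tau> = \<epsilon> * c / 2"
  have "\<tau> > 0" using \<open>\<epsilon> > 0\<close> c(1) by (simp add: \<tau>_def)
  \<comment> \<open>The denominator \<open>m + 1\<close> is the chain length \<open>m\<close>, shifted to be positive also for \<open>m = 0\<close>; the
    power of \<open>2\<close> compensates for the size of the smallest cubes in the chain.\<close>
  define \<delta> where "\<delta> = (\<tau> / (m + 1))\<^sup>2 / 2 ^ (m * CARD('n))"
  have "\<delta> > 0" using \<open>\<tau> > 0\<close> by (simp add: \<delta>_def)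
  have "m * sqrt (\<delta> * 2 ^ (m * CARD('n))) = m * (\<tau> / (m + 1))"
    using \<open>\<tau> > 0\<close> by (simp add: \<delta>_def)
  also have "\<dots> \<le> \<tau>" using \<open>\<tau> > 0\<close> by (simp add: field_simps)
  finally have chain: "m * sqrt (\<delta> * 2 ^ (m * CARD('n))) \<le> \<tau>" .
  show "\<exists>(k :: nat) (\<delta> :: real). \<delta> > 0 \<and>
    (\<forall>(h :: real ^ 'n \<Rightarrow> real) Q.
       square_integrable h \<longrightarrow> Q \<in> dyadic_cubes \<longrightarrow>
       (AE x in lebesgue. h x \<ge> 0) \<longrightarrow>
       (L2_norm_on Q h)\<^sup>2 \<le> M * side_length Q ^ CARD('n) \<longrightarrow>
       Delta_squared k h Q \<le> \<delta> * side_length Q ^ CARD('n) \<longrightarrow>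
       (\<forall>E \<in> rescaled_family (\<E> L) Q.
          \<bar>(LINT x:E|lebesgue. h x) / measure lebesgue E
            - (LINT x:Q|lebesgue. h x) / measure lebesgue Q\<bar> \<le> \<epsilon>))"
  proof (intro exI[of _ m] exI[of _ \<delta>] conjI allI impI ballI)
    show "\<delta> > 0" by fact
    fix h :: "real ^ 'n \<Rightarrow> real" and Q E
    assume h: "square_integrable h" and Q: "Q \<in> dyadic_cubes"
      and M: "(L2_norm_on Q h)\<^sup>2 \<le> M * side_length Q ^ CARD('n)"
      and D: "Delta_squared m h Q \<le> \<delta> * side_length Q ^ CARD('n)"
      and "E \<in> rescaled_family (\<E> L) Q"
    then obtain E0 where E0: "E0 \<in> \<E> L" "E = cube_map Q ` E0"
      by (auto simp: rescaled_family_def)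
    obtain C0 where C0: "C0 \<subseteq> dyadic_descendants m unit_cube"
      "measure lebesgue (sym_diff (E0 \<inter> unit_cube) (\<Union>C0)) < \<eta>"
      using m[OF E0(1)] by blast
    define C where "C = (`) (cube_map Q) ` C0"
    have C: "C \<subseteq> dyadic_descendants m Q"
      using C0(1) cube_map_dyadic_descendant[OF Q] by (auto simp: C_def)
    let ?v = "side_length Q ^ CARD('n)"
    have v: "?v > 0" using side_length_pos[OF Q] by simp
    have Em: "E \<in> sets lebesgue" unfolding E0(2) by (intro sets_cube_map Q \<E> E0)
    have Qm: "Q \<in> lmeasurable" using Q by (rule dyadic_cube_lmeasurable)
    have inj: "inj (cube_map Q)" using Q by (rule inj_cube_map)
    have EQ: "E \<inter> Q = cube_map Q ` (E0 \<inter> unit_cube)"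
      by (metis E0(2) image_Int[OF inj] cube_map_unit_cube[OF Q])
    have UC: "\<Union>C = cube_map Q ` \<Union>C0" by (auto simp: C_def)
    \<comment> \<open>The image of the closed unit cube exceeds \<open>Q\<close> by part of its boundary, a null set, so \<open>E\<close> may be
      replaced by \<open>E \<inter> Q\<close>.\<close>
    have "negligible (E0 - unit_cube)"
    proof (rule negligible_subset)
      have "(\<chi> i. 1) = (1 :: real ^ 'n)" by (simp add: vec_eq_iff)
      then show "negligible (cbox 0 1 - (unit_cube :: (real ^ 'n) set))"
        using negligible_cbox_minus_half_open_cube[of 1 "0 :: real ^ 'n"] by simp
    qed (use \<E>(2)[OF E0(1)] in auto)
    then have "negligible (cube_map Q ` (E0 - unit_cube))" by (rule negligible_cube_map[OF Q])
    also have "cube_map Q ` (E0 - unit_cube) = E - Q"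
      by (metis E0(2) image_set_diff[OF inj] cube_map_unit_cube[OF Q])
    finally have null: "E - Q \<in> null_sets lebesgue" by (simp add: negligible_iff_null_sets)
    have mE: "measure lebesgue (E \<inter> Q) = measure lebesgue E"
      using measure_Diff_null_set[OF Em null] by (simp add: Diff_Diff_Int)
    have iE: "(LINT x:E \<inter> Q|lebesgue. h x) = (LINT x:E|lebesgue. h x)"
    proof (rule set_integral_cong_set)
      show "AE x in lebesgue. x \<in> E \<longleftrightarrow> x \<in> E \<inter> Q"
        using AE_not_in[OF null] by eventually_elim auto
    qed (use h Em Qm in \<open>auto simp: set_borel_measurable_def square_integrable_def\<close>)
    have "sym_diff (E \<inter> Q) (\<Union>C) = cube_map Q ` sym_diff (E0 \<inter> unit_cube) (\<Union>C0)"
      by (simp only: EQ UC image_Un image_set_diff[OF inj])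
    then have small: "measure lebesgue (sym_diff (E \<inter> Q) (\<Union>C)) \<le> ?v * \<eta>"
      using C0(2) v by (simp add: measure_cube_map[OF Q])
    have "(L2_norm_on Q h)\<^sup>2 = (LINT x:Q|lebesgue. (h x)\<^sup>2)"
      unfolding L2_norm_on_def
      by (intro real_sqrt_pow2) (simp add: set_lebesgue_integral_def integral_nonneg_AE)
    with M have hM: "(LINT x:Q|lebesgue. (h x)\<^sup>2) / (2 * t) \<le> M * ?v / (2 * t)"
      using \<open>t > 0\<close> by (intro divide_right_mono) auto
    have "\<bar>average h R - average h Q\<bar> \<le> \<tau>" if "R \<in> C" for R
      using average_dyadic_descendant_bound[OF Q D, of R m] chain that C by auto
    then have "\<bar>(LINT x:E \<inter> Q|lebesgue. h x) - average h Q * measure lebesgue (E \<inter> Q)\<bar> \<le>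
        \<tau> * measure lebesgue Q + (LINT x:Q|lebesgue. (h x)\<^sup>2) / (2 * t)
          + t / 2 * measure lebesgue (sym_diff (E \<inter> Q) (\<Union>C))"
      using \<open>\<tau> > 0\<close> \<open>t > 0\<close> Em Qm by (intro set_integral_deviation[OF h Q C]) auto
    also have "\<dots> \<le> \<tau> * ?v + M * ?v / (2 * t) + t / 2 * (?v * \<eta>)"
      using hM small \<open>t > 0\<close> \<open>\<tau> > 0\<close> measure_dyadic_cube[OF Q]
      by (intro add_mono mult_left_mono) auto
    also have "\<dots> = \<epsilon> * (?v * c)"
      using \<open>\<epsilon> > 0\<close> \<open>M > 0\<close> c(1) by (simp add: \<tau>_def t_def \<eta>_def field_simps)
    also have "?v * c \<le> measure lebesgue E"
      using c(2)[OF E0(1)] v by (simp add: E0(2) measure_cube_map[OF Q])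
    finally have "\<bar>(LINT x:E|lebesgue. h x) - average h Q * measure lebesgue E\<bar>
        \<le> \<epsilon> * measure lebesgue E"
      using \<open>\<epsilon> > 0\<close> by (simp add: mE iE)
    moreover have "measure lebesgue E > 0"
      using mult_pos_pos[OF v c(1)] \<open>?v * c \<le> measure lebesgue E\<close> by linarith
    ultimately have "\<bar>(LINT x:E|lebesgue. h x) / measure lebesgue E - average h Q\<bar> \<le> \<epsilon>"
      by (simp add: abs_le_iff field_simps)
    then show "\<bar>(LINT x:E|lebesgue. h x) / measure lebesgue E
        - (LINT x:Q|lebesgue. h x) / measure lebesgue Q\<bar> \<le> \<epsilon>"
      by (simp add: average_def)
  qed
qed

end
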